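(* Consider a left-invariant Lorentzian problem on $G=\mathrm{Aff}_+(\mathbb R)$ given by a matrix $A=\begin{pmatrix}a&b\\c&d\end{pmatrix}$, $|A|>0$, $a\ge0$, with sectional curvature $K=0$. The Lorentzian spheres $S(R)=\{q\in G:d(\mathrm{Id},q)=R\}$, $R\in[0,+\infty]$, are as follows. (1) $S(0)=\{q\in G:\lambda_1(q)\ge0\text{ or }\lambda_2(q)\le0\}$. (2) If $R\in(0,+\infty)$, then $$S(R)=\{(x,y)\in G:\ (w+\sigma^2)y=w\},\qquad w=\frac{x+\mathsf g(y-1)}{f},\quad \sigma=\gamma R;$$ it is an arc of a hyperbola noncompact in both directions. (3) $S(+\infty)=\emptyset$.
   Context: $G=\mathrm{Aff}_+(\mathbb R)=\{(x,y)\in\mathbb R^2: y>0\}$ with product $(x_2,y_2)\cdot(x_1,y_1)=(x_2+y_2x_1,\,y_2y_1)$ and identity $\mathrm{Id}=(0,1)$; left-invariant frame $X_1=y\,\partial_x$, $X_2=y\,\partial_y$. A real matrix $A=\begin{pmatrix}a&b\\c&d\end{pmatrix}$ with $|A|=ad-bc>0$ determines the left-invariant Lorentzian form $g(u_1X_1+u_2X_2)=-v_1^2+v_2^2$, $v_1=au_1+bu_2$, $v_2=cu_1+du_2$, with time orientation in which future directed nonspacelike vectors are those with $v_1\ge|v_2|$. Standing assumption of the paper: $a\ge0$. Write $A^{-1}=\begin{pmatrix}\alpha&\beta\\ \gamma&\delta\end{pmatrix}$. The sectional curvature is $K=(c^2-a^2)/|A|^2=\gamma^2-\delta^2$. A future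 directed nonspacelike curve is a Lipschitz curve whose velocity is a.e. future directed nonspacelike; its Lorentzian length is $\int\sqrt{v_1^2-v_2^2}\,dt$. The Lorentzian distance $d(q_0,q_1)$ is the supremum of lengths of such curves from $q_0$ to $q_1$, and $0$ if there are none. $\lambda_1(x,y)=(c-a)x+(d-b)(y-1)$, $\lambda_2(x,y)=(c+a)x+(d+b)(y-1)$ (here $d$ is the matrix entry). For $K=0$: $s_1=\operatorname{sgn}\gamma$, $f=-\frac{\alpha-s_1\beta}{2\gamma}$, $\mathsf g=-\frac{\alpha+s_1\beta}{2\gamma}$. "Noncompact" refers to the topology of $G$.
   Formalization: In (2) the equation (w+σ²)y=w cuts out two arcs in G, one of which lies in S(0); the formal statement therefore takes S(R) to be the points of G on this curve that also satisfy λ₁<0 and λ₂>0. *)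

theory Defs
  imports "HOL-Analysis.Analysis"
begin

section \<open>The group of orientation preserving affine maps of the line\<close>

definition Aff :: "(real \<times> real) set" where
  "Aff = {(x, y). y > 0}"

definition aff_mult :: "real \<times> real \<Rightarrow> real \<times> real \<Rightarrow> real \<times> real" where
  "aff_mult q2 q1 = (fst q2 + snd q2 * fst q1, snd q2 * snd q1)"

definition aff_id :: "real \<times> real" where
  "aff_id = (0, 1)"

text \<open>The frame \<open>X\<^sub>1 = y \<partial>\<^sub>x\<close>, \<open>X\<^sub>2 = y \<partial>\<^sub>y\<close> and the components, in this frame, of a
  tangent vector \<open>v\<close> at \<open>q\<close>.\<close>

definition frame1 :: "real \<times> real \<Rightarrow> real \<times> real" where
  "frame1 q = (snd q, 0)"

definition frame2 :: "real \<times> real \<Rightarrow> real \<times> real" where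
  "frame2 q = (0, snd q)"

definition frame_coords :: "real \<times> real \<Rightarrow> real \<times> real \<Rightarrow> real ^ 2" where
  "frame_coords q v = vector [fst v / snd q, snd v / snd q]"

lemma frame_coords_decomp:
  assumes "q \<in> Aff"
  shows "v = u $ 1 *\<^sub>R frame1 q + u $ 2 *\<^sub>R frame2 q \<longleftrightarrow> u = frame_coords q v"
  using assms
  by (auto simp: Aff_def frame1_def frame2_def frame_coords_def vec_eq_iff forall_2
      prod_eq_iff field_simps)

lemma left_translation_has_derivative:
  "(aff_mult p has_derivative (\<lambda>v. snd p *\<^sub>R v)) (at q)"
proof -
  have "aff_mult p = (\<lambda>q. (fst p, 0) + snd p *\<^sub>R q)"
    by (auto simp: aff_mult_def prod_eq_iff)
  then show ?thesis
    by (auto intro!: derivative_eq_intros)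
qed

lemma frame_coords_left_invariant:
  assumes "p \<in> Aff"
  shows "frame_coords (aff_mult p q) (snd p *\<^sub>R v) = frame_coords q v"
  using assms by (auto simp: Aff_def frame_coords_def aff_mult_def)


section \<open>Left-invariant Lorentzian structures\<close>

text \<open>Left-invariant vector fields are represented by their constant components
  \<open>u :: real ^ 2\<close> in the frame \<open>X\<^sub>1, X\<^sub>2\<close>.\<close>

definition lorentz_form :: "real ^ 2 ^ 2 \<Rightarrow> real ^ 2 \<Rightarrow> real ^ 2 \<Rightarrow> real" where
  "lorentz_form A u w = - (A *v u) $ 1 * (A *v w) $ 1 + (A *v u) $ 2 * (A *v w) $ 2"

definition future_nonspacelike :: "real ^ 2 ^ 2 \<Rightarrow> real ^ 2 \<Rightarrow> bool" where
  "future_nonspacelike A u \<longleftrightarrow> (A *v u) $ 1 \<ge> \<bar>(A *v u) $ 2\<bar>"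

text \<open>Lie bracket of left-invariant fields; it is determined by \<open>[X\<^sub>1, X\<^sub>2] = - X\<^sub>1\<close>.\<close>

definition lie_bracket :: "real ^ 2 \<Rightarrow> real ^ 2 \<Rightarrow> real ^ 2" where
  "lie_bracket u w = vector [- (u $ 1 * w $ 2 - u $ 2 * w $ 1), 0]"

text \<open>Levi-Civita connection on left-invariant fields, given by the Koszul formula. The terms
  differentiating inner products vanish, since inner products of left-invariant fields are
  constant.\<close>

definition levi_civita :: "real ^ 2 ^ 2 \<Rightarrow> real ^ 2 \<Rightarrow> real ^ 2 \<Rightarrow> real ^ 2" where
  "levi_civita A u v = (THE z. \<forall>w. 2 * lorentz_form A z w =
     lorentz_form A (lie_bracket u v) w - lorentz_form A (lie_bracket v w) u
     + lorentz_form A (lie_bracket w u) v)"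

definition riemann_curvature ::
  "real ^ 2 ^ 2 \<Rightarrow> real ^ 2 \<Rightarrow> real ^ 2 \<Rightarrow> real ^ 2 \<Rightarrow> real ^ 2" where
  "riemann_curvature A u v w =
     levi_civita A u (levi_civita A v w) - levi_civita A v (levi_civita A u w)
     - levi_civita A (lie_bracket u v) w"

definition sectional_curvature :: "real ^ 2 ^ 2 \<Rightarrow> real" where
  "sectional_curvature A =
     (let e1 = axis 1 1; e2 = axis 2 1 in
      lorentz_form A (riemann_curvature A e1 e2 e2) e1
      / (lorentz_form A e1 e1 * lorentz_form A e2 e2 - (lorentz_form A e1 e2)\<^sup>2))"

lemma mv2: "((A :: real ^ 2 ^ 2) *v u) $ i = A $ i $ 1 * u $ 1 + A $ i $ 2 * u $ 2"
  by (simp add: matrix_vector_mult_def sum_2)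

lemma levi_civita_eq:
  fixes A :: "real ^ 2 ^ 2"
  assumes "det A \<noteq> 0"
  defines "g11 \<equiv> (A $ 2 $ 1)\<^sup>2 - (A $ 1 $ 1)\<^sup>2"
    and "g12 \<equiv> A $ 2 $ 1 * A $ 2 $ 2 - A $ 1 $ 1 * A $ 1 $ 2"
    and "g22 \<equiv> (A $ 2 $ 2)\<^sup>2 - (A $ 1 $ 2)\<^sup>2"
  shows "levi_civita A u v =
    (let m = u $ 1 * g11 + u $ 2 * g12; k = (det A)\<^sup>2 in
     vector [m * (v $ 2 * g22 + v $ 1 * g12) / k, - (m * (v $ 1 * g11 + v $ 2 * g12) / k)])"
  (is "_ = ?z")
proof -
  let ?k = "(det A)\<^sup>2"
  have k: "?k \<noteq> 0" using assms by simp
  have kk: "?k = g12\<^sup>2 - g11 * g22"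
    unfolding assms det_2 by algebra
  have lf: "lorentz_form A z w = g11 * z $ 1 * w $ 1 + g12 * (z $ 1 * w $ 2 + z $ 2 * w $ 1)
      + g22 * z $ 2 * w $ 2" for z w
    unfolding lorentz_form_def mv2 assms by algebra
  let ?m = "u $ 1 * g11 + u $ 2 * g12"
  have z12: "?k * ?z $ 1 = ?m * (v $ 2 * g22 + v $ 1 * g12)"
      "?k * ?z $ 2 = - (?m * (v $ 1 * g11 + v $ 2 * g12))"
    using assms(1) by (simp_all add: Let_def)
  have "?k * (g11 * ?z $ 1 + g12 * ?z $ 2) = ?k * (- ?m * v $ 2)"
    using z12 kk by algebra
  then have a1: "g11 * ?z $ 1 + g12 * ?z $ 2 = - ?m * v $ 2"
    using k mult_cancel_left by blast
  have "?k * (g12 * ?z $ 1 + g22 * ?z $ 2) = ?k * (?m * v $ 1)"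
    using z12 kk by algebra
  then have a2: "g12 * ?z $ 1 + g22 * ?z $ 2 = ?m * v $ 1"
    using k mult_cancel_left by blast
  have eq: "2 * lorentz_form A ?z w =
     lorentz_form A (lie_bracket u v) w - lorentz_form A (lie_bracket v w) u
     + lorentz_form A (lie_bracket w u) v" for w
  proof -
    have "2 * lorentz_form A ?z w = 2 * (- ?m * v $ 2 * w $ 1 + ?m * v $ 1 * w $ 2)"
      unfolding lf a1[symmetric] a2[symmetric] by algebra
    then show ?thesis
      unfolding lf lie_bracket_def by (simp add: algebra_simps)
  qed
  show ?thesis
    unfolding levi_civita_def
  proof (rule the_equality)
    show "\<forall>w. 2 * lorentz_form A ?z w =
     lorentz_form A (lie_bracket u v) w - lorentz_form A (lie_bracket v w) u
     + lorentz_form A (lie_bracket w u) v" using eq by blast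
  next
    fix z assume "\<forall>w. 2 * lorentz_form A z w =
     lorentz_form A (lie_bracket u v) w - lorentz_form A (lie_bracket v w) u
     + lorentz_form A (lie_bracket w u) v"
    then have e: "lorentz_form A z w = lorentz_form A ?z w" for w
      using eq[of w] by (metis mult_cancel_left zero_neq_numeral)
    have "g11 * z $ 1 + g12 * z $ 2 = g11 * ?z $ 1 + g12 * ?z $ 2"
      using e[of "axis 1 1"] unfolding lf by (simp add: axis_def)
    moreover have "g12 * z $ 1 + g22 * z $ 2 = g12 * ?z $ 1 + g22 * ?z $ 2"
      using e[of "axis 2 1"] unfolding lf by (simp add: axis_def)
    ultimately have "?k * (z $ 1 - ?z $ 1) = 0" "?k * (z $ 2 - ?z $ 2) = 0"
      unfolding kk by algebra+
    then show "z = ?z" using k by (simp add: vec_eq_iff forall_2)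
  qed
qed

lemma sectional_curvature_eq:
  assumes "det A \<noteq> 0"
  shows "sectional_curvature A = ((A $ 2 $ 1)\<^sup>2 - (A $ 1 $ 1)\<^sup>2) / (det A)\<^sup>2"
proof -
  define g11 where "g11 = (A $ 2 $ 1)\<^sup>2 - (A $ 1 $ 1)\<^sup>2"
  define g12 where "g12 = A $ 2 $ 1 * A $ 2 $ 2 - A $ 1 $ 1 * A $ 1 $ 2"
  define g22 where "g22 = (A $ 2 $ 2)\<^sup>2 - (A $ 1 $ 2)\<^sup>2"
  define k where "k = (det A)\<^sup>2"
  have k: "k \<noteq> 0" using assms by (simp add: k_def)
  have kk: "k = g12\<^sup>2 - g11 * g22"
    unfolding k_def det_2 g11_def g12_def g22_def by algebra
  have lf: "lorentz_form A z w = g11 * z $ 1 * w $ 1 + g12 * (z $ 1 * w $ 2 + z $ 2 * w $ 1)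
      + g22 * z $ 2 * w $ 2" for z w
    unfolding lorentz_form_def mv2 g11_def g12_def g22_def by algebra
  have lc: "levi_civita A u v =
     vector [(u $ 1 * g11 + u $ 2 * g12) * (v $ 2 * g22 + v $ 1 * g12) / k,
       - ((u $ 1 * g11 + u $ 2 * g12) * (v $ 1 * g11 + v $ 2 * g12) / k)]" for u v
    unfolding levi_civita_eq[OF assms] Let_def g11_def g12_def g22_def k_def by simp
  have ax: "axis 1 1 $ (1::2) = (1::real)" "axis 1 1 $ (2::2) = (0::real)"
     "axis 2 1 $ (1::2) = (0::real)" "axis 2 1 $ (2::2) = (1::real)" by (simp_all add: axis_def)
  have den: "lorentz_form A (axis 1 1) (axis 1 1) * lorentz_form A (axis 2 1) (axis 2 1)
      - (lorentz_form A (axis 1 1) (axis 2 1))\<^sup>2 = - k"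
    unfolding lf kk ax by simp
  let ?r = "riemann_curvature A (axis 1 1) (axis 2 1) (axis 2 1)"
  have r: "?r $ 1 = g11 * g22 / k" "?r $ 2 = - g11 * g12 / k"
    unfolding riemann_curvature_def lc lie_bracket_def
    by (simp_all add: ax field_simps)
  have "lorentz_form A ?r (axis 1 1) = - g11"
  proof -
    have "k * ?r $ 1 = g11 * g22" "k * ?r $ 2 = - g11 * g12"
      using k by (simp_all add: r)
    then have "k * lorentz_form A ?r (axis 1 1) = k * (- g11)"
      unfolding lf ax using kk by algebra
    then show ?thesis using k mult_cancel_left by blast
  qed
  then show ?thesis
    unfolding sectional_curvature_def Let_def den using k
    by (simp add: g11_def k_def diff_divide_distrib)
qed


section \<open>Lorentzian distance\<close>

definition velocity :: "(real \<Rightarrow> real \<times> real) \<Rightarrow> real \<Rightarrow> real \<Rightarrow> real \<Rightarrow> real ^ 2" where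
  "velocity c t0 t1 t = frame_coords (c t) (vector_derivative c (at t within {t0..t1}))"

definition admissible ::
  "real ^ 2 ^ 2 \<Rightarrow> (real \<Rightarrow> real \<times> real) \<Rightarrow> real \<Rightarrow> real \<Rightarrow> bool" where
  "admissible A c t0 t1 \<longleftrightarrow> t0 < t1 \<and> c ` {t0..t1} \<subseteq> Aff \<and>
     (\<exists>L. L-lipschitz_on {t0..t1} c) \<and>
     (AE t in lebesgue_on {t0..t1}. c differentiable (at t within {t0..t1}) \<and>
        future_nonspacelike A (velocity c t0 t1 t))"

definition lorentz_length ::
  "real ^ 2 ^ 2 \<Rightarrow> (real \<Rightarrow> real \<times> real) \<Rightarrow> real \<Rightarrow> real \<Rightarrow> ennreal" where
  "lorentz_length A c t0 t1 =
     (\<integral>\<^sup>+ t. ennreal (sqrt (((A *v velocity c t0 t1 t) $ 1)\<^sup>2 - ((A *v velocity c t0 t1 t) $ 2)\<^sup>2))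
        \<partial>lebesgue_on {t0..t1})"

text \<open>The supremum of the empty set in \<^typ>\<open>ennreal\<close> is \<open>0\<close>, as required when no
  admissible curve joins the two points.\<close>

definition lorentz_dist :: "real ^ 2 ^ 2 \<Rightarrow> real \<times> real \<Rightarrow> real \<times> real \<Rightarrow> ennreal" where
  "lorentz_dist A q0 q1 =
     Sup {lorentz_length A c t0 t1 | c t0 t1. admissible A c t0 t1 \<and> c t0 = q0 \<and> c t1 = q1}"

definition lorentz_sphere :: "real ^ 2 ^ 2 \<Rightarrow> ennreal \<Rightarrow> (real \<times> real) set" where
  "lorentz_sphere A R = {q \<in> Aff. lorentz_dist A aff_id q = R}"


section \<open>The functions describing the spheres\<close>

definition lambda1 :: "real ^ 2 ^ 2 \<Rightarrow> real \<times> real \<Rightarrow> real" where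
  "lambda1 A q = (A $ 2 $ 1 - A $ 1 $ 1) * fst q + (A $ 2 $ 2 - A $ 1 $ 2) * (snd q - 1)"

definition lambda2 :: "real ^ 2 ^ 2 \<Rightarrow> real \<times> real \<Rightarrow> real" where
  "lambda2 A q = (A $ 2 $ 1 + A $ 1 $ 1) * fst q + (A $ 2 $ 2 + A $ 1 $ 2) * (snd q - 1)"

definition f_coeff :: "real ^ 2 ^ 2 \<Rightarrow> real" where
  "f_coeff A = (let B = matrix_inv A; s1 = sgn (B $ 2 $ 1) in
     - (B $ 1 $ 1 - s1 * B $ 1 $ 2) / (2 * B $ 2 $ 1))"

definition g_coeff :: "real ^ 2 ^ 2 \<Rightarrow> real" where
  "g_coeff A = (let B = matrix_inv A; s1 = sgn (B $ 2 $ 1) in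
     - (B $ 1 $ 1 + s1 * B $ 1 $ 2) / (2 * B $ 2 $ 1))"

text \<open>The whole plane curve \<open>(w + \<sigma>\<^sup>2) y = w\<close>, not restricted to \<open>y > 0\<close>.
  For \<open>\<sigma> \<noteq> 0\<close> it meets the group in two arcs, one with \<open>y < 1\<close> and one with \<open>y > 1\<close>. Only one of
  them lies in the future of the identity, where \<open>\<lambda>\<^sub>1 < 0 < \<lambda>\<^sub>2\<close>, so that a sphere is given by the
  equation together with these inequalities.\<close>

definition sphere_curve :: "real ^ 2 ^ 2 \<Rightarrow> real \<Rightarrow> (real \<times> real) set" where
  "sphere_curve A R = {(x, y).
     let w = (x + g_coeff A * (y - 1)) / f_coeff A; \<sigma> = matrix_inv A $ 2 $ 1 * R
     in (w + \<sigma>\<^sup>2) * y = w}"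

text \<open>Hyperbolas as nondegenerate conics of hyperbolic type: the discriminant of the quadratic
  part is positive and four times the determinant of the symmetric \<open>3 \<times> 3\<close> matrix of the
  conic does not vanish.\<close>

definition is_hyperbola :: "(real \<times> real) set \<Rightarrow> bool" where
  "is_hyperbola H \<longleftrightarrow> (\<exists>p q r s t u.
     H = {(x, y). p * x\<^sup>2 + q * x * y + r * y\<^sup>2 + s * x + t * y + u = 0} \<and>
     q\<^sup>2 - 4 * p * r > 0 \<and>
     4 * p * r * u + q * s * t - p * t\<^sup>2 - r * s\<^sup>2 - u * q\<^sup>2 \<noteq> 0)"

text \<open>An injectively parametrized curve in the group both of whose ends leave every compact
  subset of the group (not of the plane: an end may converge to a point of \<open>y = 0\<close>).\<close>

definition noncompact_arc :: "(real \<times> real) set \<Rightarrow> bool" where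
  "noncompact_arc S \<longleftrightarrow> (\<exists>\<phi> :: real \<Rightarrow> real \<times> real.
     continuous_on UNIV \<phi> \<and> inj \<phi> \<and> range \<phi> = S \<and> S \<subseteq> Aff \<and>
     (\<forall>K. compact K \<and> K \<subseteq> Aff \<longrightarrow>
        (\<forall>\<^sub>F t in at_top. \<phi> t \<notin> K) \<and> (\<forall>\<^sub>F t in at_bot. \<phi> t \<notin> K)))"

end

theory Submission imports Defs begin

text \<open>
  Vanishing curvature means \<open>c = s a\<close> with a sign \<open>s\<close>, and then \<open>a > 0\<close> and
  \<open>D = d - s b > 0\<close> because \<open>a D\<close> is the determinant. One of the two null directions of the form is
  therefore spanned by \<open>X\<^sub>1\<close>, and the metric \<open>- v\<^sub>1\<^sup>2 + v\<^sub>2\<^sup>2\<close> splits explicitly: with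
  \<open>E = b + s d\<close> and the functions \<open>T = s D (1 / y - 1)\<close> and \<open>Q = 2 a x + E (y - 1)\<close>, which
  vanish at the identity, \<open>v\<^sub>1\<^sup>2 - v\<^sub>2\<^sup>2\<close> is the product of the derivatives \<open>T'\<close> and \<open>Q'\<close> along a
  curve, and a velocity is future directed nonspacelike exactly if \<open>T' \<ge> 0\<close> and \<open>Q' \<ge> 0\<close>. So
  \<open>(T, Q)\<close> is a chart by null coordinates that identifies the group with a half plane in the
  Minkowski plane.

  In such a chart the distance is that of the Minkowski plane. Along an admissible curve
  \<open>\<integral> sqrt (T' Q') \<le> sqrt (\<Delta>T \<Delta>Q)\<close> by the Cauchy--Schwarz inequality, here obtained from the weighted
  inequalities \<open>sqrt (T' Q') \<le> (k T' + Q' / k) / 2\<close> and the fundamental theorem of calculus for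
  Lipschitz functions (\<open>admissible_bounds\<close>); the segment that is straight in the chart attains the
  bound (\<open>exists_maximizer\<close>). Hence the distance from the identity is \<open>sqrt (T Q)\<close> where \<open>T\<close> and
  \<open>Q\<close> are positive and \<open>0\<close> elsewhere (\<open>lorentz_dist_eq\<close>); in particular it is finite.

  The theorem is a translation of this formula. The pair of conditions \<open>\<lambda>\<^sub>1 < 0 < \<lambda>\<^sub>2\<close> says that \<open>T\<close>
  and \<open>Q\<close> are positive, since \<open>{- \<lambda>\<^sub>1, \<lambda>\<^sub>2} = {y T, Q}\<close>, and the equation of the sphere of radius
  \<open>R\<close> is \<open>T Q = R\<^sup>2\<close>. Multiplied by \<open>y\<close> this is a nondegenerate conic, and the branch on which
  \<open>T\<close> and \<open>Q\<close> are positive is parametrized by \<open>y\<close>: at one end \<open>T \<rightarrow> 0\<close> and so \<open>Q \<rightarrow> \<infinity>\<close>, at the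
  other end \<open>y\<close> tends to \<open>0\<close> or to \<open>\<infinity>\<close>.
\<close>

section \<open>Integration of derivatives of Lipschitz functions\<close>

text \<open>The difference quotients of \<open>f\<close> are bounded by the Lipschitz constant and converge to \<open>f'\<close>
  off \<open>N\<close> and the end points, so dominated convergence applies; their integrals are computed with
  a primitive \<open>F\<close> of \<open>f\<close>, extended by constants, and converge to \<open>F' b - F' a\<close>. The integral is taken over a set on
  which \<open>f'\<close> is the derivative everywhere, because nothing is known about \<open>f'\<close> elsewhere.\<close>

lemma lipschitz_integral_derivative:
  fixes f f' :: "real \<Rightarrow> real"
  assumes ab: "a < b" and lip: "L-lipschitz_on {a..b} f"
    and N: "negligible N"
    and der: "\<And>t. t \<in> {a..b} - N \<Longrightarrow> (f has_real_derivative f' t) (at t within {a..b})"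
  shows "(f' has_integral (f b - f a)) ({a<..<b} - N)"
proof -
  \<comment> \<open>The quotients need values of \<open>f\<close> beyond \<open>b\<close>: extend \<open>f\<close> by constants.\<close>
  define g where "g t = f (max a (min b t))" for t
  have clampin: "max a (min b t) \<in> {a..b}" for t using ab by auto
  have g_lip: "\<bar>g s - g t\<bar> \<le> L * \<bar>s - t\<bar>" for s t
  proof -
    have "\<bar>g s - g t\<bar> \<le> L * \<bar>max a (min b s) - max a (min b t)\<bar>"
      using lipschitz_onD[OF lip clampin clampin] unfolding g_def dist_real_def .
    also have "\<dots> \<le> L * \<bar>s - t\<bar>"
      using lipschitz_on_nonneg[OF lip] by (intro mult_left_mono) auto
    finally show ?thesis .
  qed
  have "L-lipschitz_on UNIV g"
    using g_lip lipschitz_on_nonneg[OF lip] by (intro lipschitz_onI) (auto simp: dist_real_def)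
  then have g_cont: "continuous_on X g" for X
    using continuous_on_subset lipschitz_on_continuous_on by blast
  \<comment> \<open>The margins make every point of \<open>{a..b + 1}\<close> interior, so that \<open>F\<close> has two-sided derivatives.\<close>
  define F where "F x = integral {a-1..x} g" for x
  have F_der: "(F has_real_derivative g x) (at x)" if "a - 1 < x" "x < b + 2" for x
  proof -
    have "((\<lambda>u. integral {a-1..u} g) has_vector_derivative g x) (at x within {a-1..b+2})"
      using that by (intro integral_has_vector_derivative g_cont) auto
    moreover have "at x within {a-1..b+2} = at x"
      using that by (intro at_within_interior) auto
    ultimately show ?thesis
      unfolding F_def has_real_derivative_iff_has_vector_derivative by simp
  qed
  define h where "h k = inverse (real (Suc k))" for k
  have h: "0 < h k" "h k \<le> 1" for k by (simp_all add: h_def field_simps)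
  have h_at: "filterlim h (at 0) sequentially"
    unfolding filterlim_at using h(1) LIMSEQ_inverse_real_of_nat
    by (auto simp: h_def[abs_def])
  define q where "q k t = (g (t + h k) - g t) / h k" for k t
  define y where "y k = (F (b + h k) - F b) / h k - (F (a + h k) - F a) / h k" for k
  have shift: "((\<lambda>t. g (t + e)) has_integral (F (b + e) - F (a + e))) {a..b}"
    if "0 \<le> e" "e \<le> 1" for e
  proof (rule fundamental_theorem_of_calculus)
    show "a \<le> b" using ab by simp
    fix t assume t: "t \<in> {a..b}"
    have "((\<lambda>t. F (t + e)) has_real_derivative g (t + e) * 1) (at t)"
      using that t by (intro DERIV_chain2[OF F_der]) (auto intro!: derivative_eq_intros)
    then show "((\<lambda>t. F (t + e)) has_vector_derivative g (t + e)) (at t within {a..b})"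
      by (simp add: has_real_derivative_iff_has_vector_derivative has_vector_derivative_at_within)
  qed
  have q_int: "(q k has_integral y k) {a..b}" for k
  proof -
    have "((\<lambda>t. (g (t + h k) - g (t + 0)) / h k) has_integral
        ((F (b + h k) - F (a + h k)) - (F (b + 0) - F (a + 0))) / h k) {a..b}"
      using h[of k] by (intro has_integral_divide has_integral_diff shift) auto
    then show ?thesis
      by (simp add: q_def[abs_def] y_def diff_divide_distrib add_divide_distrib algebra_simps)
  qed
  have lim_quot: "(\<lambda>k. (G (x + h k) - G x) / h k) \<longlonglongrightarrow> G'"
    if "(G has_real_derivative G') (at x)" for G G' x
    using that unfolding DERIV_def by (rule filterlim_compose[OF _ h_at])
  have "y \<longlonglongrightarrow> g b - g a"
    unfolding y_def[abs_def] using ab by (intro tendsto_diff lim_quot F_der) auto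
  then have y_lim: "y \<longlonglongrightarrow> f b - f a" using ab by (simp add: g_def)
  have negl: "negligible (({a..b} - ({a<..<b} - N)) \<union> (({a<..<b} - N) - {a..b}))"
    by (rule negligible_subset[of "N \<union> {a,b}"]) (use N in auto)
  have negl_diff: "negligible {t \<in> {a..b} - ({a<..<b} - N). u t \<noteq> 0}"
    "negligible {t \<in> ({a<..<b} - N) - {a..b}. u t \<noteq> 0}" for u :: "real \<Rightarrow> real"
    by (auto intro: negligible_subset[OF negl])
  show ?thesis
  proof (rule has_integral_dominated_convergence[where f = q and y = y and h = "\<lambda>_. L"])
    show "(q k has_integral y k) ({a<..<b} - N)" for k
      by (rule iffD1[OF has_integral_spike_set_eq[OF negl_diff] q_int])
    have "(\<lambda>_. L) integrable_on {a..b}" by (rule integrable_const_ivl)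
    then show "(\<lambda>_. L) integrable_on ({a<..<b} - N)"
      by (rule integrable_spike_set) (rule negl_diff)+
    show "\<forall>x\<in>{a<..<b} - N. norm (q k x) \<le> L" for k
    proof
      fix x
      have "\<bar>g (x + h k) - g x\<bar> \<le> L * h k"
        using g_lip[of "x + h k" x] h(1)[of k] by simp
      then show "norm (q k x) \<le> L"
        using h(1)[of k] by (simp add: q_def divide_le_eq)
    qed
    show "\<forall>x\<in>{a<..<b} - N. (\<lambda>k. q k x) \<longlonglongrightarrow> f' x"
    proof
      fix x assume x: "x \<in> {a<..<b} - N"
      then have "(f has_real_derivative f' x) (at x within {a<..<b})"
        using der[of x] by (auto intro: DERIV_subset)
      then have "(f has_real_derivative f' x) (at x)"
        using x by (simp add: at_within_open[of x "{a<..<b}"])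
      then have "(g has_real_derivative f' x) (at x)"
        by (rule has_field_derivative_transform_within_open[where S = "{a<..<b}"])
          (use x in \<open>auto simp: g_def\<close>)
      then show "(\<lambda>k. q k x) \<longlonglongrightarrow> f' x"
        unfolding q_def by (rule lim_quot)
    qed
  qed (fact y_lim)
qed

text \<open>The nonnegative integral is the form in which lengths of curves are defined; here only
  almost everywhere assumptions on the derivative are available.\<close>

lemma nn_integral_lipschitz_derivative:
  fixes f f' :: "real \<Rightarrow> real"
  assumes ab: "a < b" and lip: "L-lipschitz_on {a..b} f"
    and ae: "AE t in lebesgue_on {a..b}.
      (f has_real_derivative f' t) (at t within {a..b}) \<and> 0 \<le> f' t"
  shows "(\<integral>\<^sup>+ t. ennreal (f' t) \<partial>lebesgue_on {a..b}) = ennreal (f b - f a)"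
    and "f a \<le> f b"
proof -
  have "AE t in lebesgue. t \<in> {a..b} \<longrightarrow>
      (f has_real_derivative f' t) (at t within {a..b}) \<and> 0 \<le> f' t"
    using ae by (subst (asm) AE_restrict_space_iff) auto
  then obtain N where N: "N \<in> null_sets lebesgue"
    and sub: "{t \<in> space lebesgue. \<not> (t \<in> {a..b} \<longrightarrow>
      (f has_real_derivative f' t) (at t within {a..b}) \<and> 0 \<le> f' t)} \<subseteq> N"
    by (auto simp: eventually_ae_filter)
  have good: "(f has_real_derivative f' t) (at t within {a..b})" "0 \<le> f' t"
    if "t \<in> {a..b} - N" for t using that sub by auto
  let ?S = "{a<..<b} - N"
  have int: "(f' has_integral (f b - f a)) ?S"
    using ab lip N good(1) by (intro lipschitz_integral_derivative) (auto simp: negligible_iff_null_sets)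
  show "f a \<le> f b"
    using has_integral_nonneg[OF int] good(2) by simp
  have "((\<lambda>t. if t \<in> ?S then f' t else 0) has_integral (f b - f a)) UNIV"
    using int by (simp only: has_integral_restrict_UNIV)
  moreover have "0 \<le> (if t \<in> ?S then f' t else 0)" for t
    using good(2)[of t] by auto
  ultimately have "(\<integral>\<^sup>+ t. ennreal (if t \<in> ?S then f' t else 0) \<partial>lebesgue) = ennreal (f b - f a)"
    by (subst (asm) has_integral_iff_nn_integral_lebesgue) auto
  moreover have "(\<integral>\<^sup>+ t. ennreal (if t \<in> ?S then f' t else 0) \<partial>lebesgue)
      = (\<integral>\<^sup>+ t. ennreal (f' t) * indicator {a..b} t \<partial>lebesgue)"
  proof (rule nn_integral_cong_AE)
    have "negligible (N \<union> {a, b})"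
      using N by (simp add: negligible_iff_null_sets[symmetric] negligible_insert)
    then have "AE t in lebesgue. t \<notin> N \<union> {a, b}"
      by (simp only: negligible_iff_null_sets AE_not_in)
    then show "AE t in lebesgue. ennreal (if t \<in> ?S then f' t else 0)
        = ennreal (f' t) * indicator {a..b} t"
      by eventually_elim (auto simp: indicator_def)
  qed
  ultimately show "(\<integral>\<^sup>+ t. ennreal (f' t) \<partial>lebesgue_on {a..b}) = ennreal (f b - f a)"
    by (simp add: nn_integral_restrict_space)
qed

text \<open>For positive \<open>p\<close> and \<open>q\<close> the weight \<open>k = sqrt (q / p)\<close> turns the mean into \<open>sqrt (p q)\<close>.
  If one of them vanishes, this weight does not exist or is not positive, so \<open>p\<close> and \<open>q\<close> are first increased by \<open>d > 0\<close>
  and then \<open>d\<close> tends to \<open>0\<close>. The lemma replaces the Cauchy--Schwarz inequality for integrals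
  by bounds that are linear in the integrand.\<close>

lemma le_sqrt_mult_of_weighted_means:
  fixes l p q :: real
  assumes "0 \<le> p" "0 \<le> q" and l: "\<And>k. 0 < k \<Longrightarrow> l \<le> (k * p + q / k) / 2"
  shows "l \<le> sqrt (p * q)"
proof -
  have key: "l \<le> sqrt ((p + d) * (q + d))" if d: "0 < d" for d
  proof -
    define u v where "u = sqrt (p + d)" and "v = sqrt (q + d)"
    have pos: "0 < u" "0 < v" and sq: "p \<le> u * u" "q \<le> v * v"
      using assms d by (auto simp: u_def v_def)
    have "l \<le> (v / u * p + q / (v / u)) / 2" using l[of "v / u"] pos by simp
    also have "\<dots> \<le> (v / u * (u * u) + (v * v) / (v / u)) / 2"
      using pos sq by (intro divide_right_mono add_mono mult_left_mono) auto
    also have "\<dots> = u * v"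
      using pos by (simp add: field_simps)
    finally show ?thesis by (simp add: u_def v_def real_sqrt_mult)
  qed
  have "((\<lambda>d. sqrt ((p + d) * (q + d))) \<longlongrightarrow> sqrt ((p + 0) * (q + 0))) (at_right 0)"
    by (intro tendsto_intros)
  moreover have "\<forall>\<^sub>F d in at_right 0. l \<le> sqrt ((p + d) * (q + d))"
    using eventually_at_right_less[of "0::real"] by eventually_elim (rule key)
  ultimately show ?thesis
    using tendsto_lowerbound[OF _ _ trivial_limit_at_right_real] by fastforce
qed

section \<open>Two by two matrices and escape from compact sets\<close>

lemma matrix_inv_2:
  fixes A :: "real ^ 2 ^ 2"
  assumes "det A \<noteq> 0"
  shows "matrix_inv A $ 1 $ 1 = A $ 2 $ 2 / det A" "matrix_inv A $ 1 $ 2 = - A $ 1 $ 2 / det A"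
    "matrix_inv A $ 2 $ 1 = - A $ 2 $ 1 / det A" "matrix_inv A $ 2 $ 2 = A $ 1 $ 1 / det A"
proof -
  define B :: "real ^ 2 ^ 2" where "B = vector [vector [A $ 2 $ 2 / det A, - A $ 1 $ 2 / det A],
    vector [- A $ 2 $ 1 / det A, A $ 1 $ 1 / det A]]"
  have "B ** A = mat 1"
    using assms
    by (auto simp: B_def vec_eq_iff forall_2 matrix_matrix_mult_def sum_2 mat_def det_2
        diff_divide_distrib[symmetric] algebra_simps)
  moreover have "A ** matrix_inv A = mat 1"
    using assms someI_ex[of "\<lambda>A'. A ** A' = mat 1 \<and> A' ** A = mat 1"]
    unfolding matrix_inv_def invertible_det_nz[symmetric] invertible_def by blast
  ultimately have "matrix_inv A = B"
    by (metis matrix_mul_assoc matrix_mul_lid matrix_mul_rid)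
  then show "matrix_inv A $ 1 $ 1 = A $ 2 $ 2 / det A" "matrix_inv A $ 1 $ 2 = - A $ 1 $ 2 / det A"
    "matrix_inv A $ 2 $ 1 = - A $ 2 $ 1 / det A" "matrix_inv A $ 2 $ 2 = A $ 1 $ 1 / det A"
    by (simp_all add: B_def)
qed

lemma eventually_notin_compact:
  fixes G :: "'a::topological_space \<Rightarrow> real"
  assumes K: "compact K" and G: "continuous_on K G"
    and lim: "filterlim (\<lambda>t. G (\<phi> t)) at_top F"
  shows "\<forall>\<^sub>F t in F. \<phi> t \<notin> K"
proof -
  obtain B where B: "\<And>q. q \<in> K \<Longrightarrow> \<bar>G q\<bar> \<le> B"
    using compact_imp_bounded[OF compact_continuous_image[OF G K]]
    unfolding bounded_iff real_norm_def by blast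
  have "\<forall>\<^sub>F t in F. B < G (\<phi> t)"
    using lim by (simp add: filterlim_at_top_dense)
  then show ?thesis by eventually_elim (use B in force)
qed

section \<open>Null coordinates of a flat structure\<close>

lemma mem_Aff_iff: "q \<in> Aff \<longleftrightarrow> 0 < snd q"
  by (auto simp: Aff_def)

text \<open>The left-invariant structures of curvature zero. The sign \<open>s\<close> treats the cases \<open>c = a\<close> and
  \<open>c = - a\<close> together: they differ in which of \<open>v\<^sub>1 - v\<^sub>2\<close> and \<open>v\<^sub>1 + v\<^sub>2\<close> has no \<open>dx\<close> part.\<close>

locale flat_structure =
  fixes A :: "real ^ 2 ^ 2" and s a D E :: real
  assumes s: "s = 1 \<or> s = -1" and a: "0 < a" and D: "0 < D"
    and A11: "A $ 1 $ 1 = a" and A21: "A $ 2 $ 1 = s * a"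
    and D_eq: "D = A $ 2 $ 2 - s * A $ 1 $ 2" and E_eq: "E = A $ 1 $ 2 + s * A $ 2 $ 2"
begin

text \<open>The null form without \<open>dx\<close> part is \<open>- s D dy / y\<close> and the other one is
  \<open>(2 a dx + E dy) / y\<close>. Moving the factor \<open>1 / y\<close> of the second to the first makes both exact,
  since \<open>dy / y\<^sup>2\<close> still depends on \<open>y\<close> only: this is where flatness enters. The primitives that vanish at the
  identity are \<open>T\<close> and \<open>Q\<close>.\<close>

definition T :: "real \<times> real \<Rightarrow> real" where
  "T q = s * D * (1 / snd q - 1)"

definition Q :: "real \<times> real \<Rightarrow> real" where
  "Q q = 2 * a * fst q + E * (snd q - 1)"

definition dT :: "real \<times> real \<Rightarrow> real \<times> real \<Rightarrow> real" where
  "dT q v = - s * D * snd v / (snd q)\<^sup>2"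

definition dQ :: "real \<times> real \<Rightarrow> real" where
  "dQ v = 2 * a * fst v + E * snd v"

text \<open>Equivalently \<open>v\<^sub>1 - s v\<^sub>2 = y dT\<close> and \<open>v\<^sub>1 + s v\<^sub>2 = dQ / y\<close>: in the product of the two null
  combinations the factors \<open>y\<close> cancel.\<close>

lemma matrix_frame_coords:
  assumes "q \<in> Aff"
  shows "(A *v frame_coords q v) $ 1 = (snd q * dT q v + dQ v / snd q) / 2"
    and "(A *v frame_coords q v) $ 2 = s * (dQ v / snd q - snd q * dT q v) / 2"
proof -
  have "snd q \<noteq> 0" using assms by (auto simp: mem_Aff_iff)
  then have "snd q * dT q v = - s * D * (snd v / snd q)"
    "dQ v / snd q = 2 * a * (fst v / snd q) + E * (snd v / snd q)"
    by (simp_all add: dT_def dQ_def power2_eq_square add_divide_distrib)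
  moreover have "s * s = 1" using s by auto
  ultimately show "(A *v frame_coords q v) $ 1 = (snd q * dT q v + dQ v / snd q) / 2"
    "(A *v frame_coords q v) $ 2 = s * (dQ v / snd q - snd q * dT q v) / 2"
    unfolding mv2 A11 A21 D_eq E_eq frame_coords_def vector_2 by algebra+
qed

lemma future_nonspacelike_iff:
  assumes "q \<in> Aff"
  shows "future_nonspacelike A (frame_coords q v) \<longleftrightarrow> 0 \<le> dT q v \<and> 0 \<le> dQ v"
proof -
  have y: "0 < snd q" using assms by (auto simp: mem_Aff_iff)
  have "\<bar>(s * w) / 2\<bar> = \<bar>w\<bar> / 2" for w using s by auto
  then have "future_nonspacelike A (frame_coords q v)
      \<longleftrightarrow> \<bar>dQ v / snd q - snd q * dT q v\<bar> \<le> snd q * dT q v + dQ v / snd q"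
    unfolding future_nonspacelike_def matrix_frame_coords[OF assms] by auto
  also have "\<dots> \<longleftrightarrow> 0 \<le> snd q * dT q v \<and> 0 \<le> dQ v / snd q" by linarith
  also have "\<dots> \<longleftrightarrow> 0 \<le> dT q v \<and> 0 \<le> dQ v"
    using y by (simp add: zero_le_mult_iff zero_le_divide_iff)
  finally show ?thesis .
qed

lemma lorentz_square_eq:
  assumes "q \<in> Aff"
  shows "((A *v frame_coords q v) $ 1)\<^sup>2 - ((A *v frame_coords q v) $ 2)\<^sup>2 = dT q v * dQ v"
proof -
  have y: "snd q \<noteq> 0" using assms by (auto simp: mem_Aff_iff)
  have "((A *v frame_coords q v) $ 1)\<^sup>2 - ((A *v frame_coords q v) $ 2)\<^sup>2
      = (snd q * dT q v) * (dQ v / snd q)"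
  proof -
    have "((p + q) / 2)\<^sup>2 - (s * (q - p) / 2)\<^sup>2 = p * q" for p q :: real
      using s by (auto simp: power2_eq_square field_simps)
    then show ?thesis unfolding matrix_frame_coords[OF assms] .
  qed
  then show ?thesis using y by simp
qed

lemma T_Q_derivative:
  assumes "(c has_vector_derivative v) (at t within X)" and "c t \<in> Aff"
  shows "((\<lambda>t. T (c t)) has_real_derivative dT (c t) v) (at t within X)"
    and "((\<lambda>t. Q (c t)) has_real_derivative dQ v) (at t within X)"
proof -
  have x: "((\<lambda>t. fst (c t)) has_real_derivative fst v) (at t within X)"
    and y: "((\<lambda>t. snd (c t)) has_real_derivative snd v) (at t within X)"
    using assms(1) unfolding has_real_derivative_iff_has_vector_derivative
    by (auto intro: bounded_linear.has_vector_derivative bounded_linear_fst bounded_linear_snd)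
  have "snd (c t) \<noteq> 0" using assms(2) by (auto simp: mem_Aff_iff)
  then show "((\<lambda>t. T (c t)) has_real_derivative dT (c t) v) (at t within X)"
    unfolding T_def dT_def
    by (auto intro!: derivative_eq_intros y simp: power2_eq_square)
  show "((\<lambda>t. Q (c t)) has_real_derivative dQ v) (at t within X)"
    unfolding Q_def dQ_def by (auto intro!: derivative_eq_intros x y)
qed

text \<open>For \<open>T\<close> this uses that the image of the curve is compact in the group, so that \<open>1 / y\<close> stays
  bounded on it.\<close>

lemma T_Q_lipschitz:
  fixes c :: "real \<Rightarrow> real \<times> real"
  assumes lip: "L-lipschitz_on {t0..t1} c" and sub: "c ` {t0..t1} \<subseteq> Aff"
  shows "\<exists>M. M-lipschitz_on {t0..t1} (\<lambda>t. T (c t))" "\<exists>M. M-lipschitz_on {t0..t1} (\<lambda>t. Q (c t))"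
proof -
  have cont: "continuous_on {t0..t1} (\<lambda>t. 1 / snd (c t))"
    using sub lipschitz_on_continuous_on[OF lip]
    by (intro continuous_intros) (auto simp: mem_Aff_iff image_subset_iff)
  obtain B where B: "\<And>t. t \<in> {t0..t1} \<Longrightarrow> \<bar>1 / snd (c t)\<bar> \<le> B"
    using compact_imp_bounded[OF compact_continuous_image[OF cont compact_Icc]]
    unfolding bounded_iff real_norm_def by blast
  have L: "0 \<le> L" using lip lipschitz_on_nonneg by blast
  have diff: "\<bar>fst (c r) - fst (c t)\<bar> \<le> L * \<bar>r - t\<bar>" "\<bar>snd (c r) - snd (c t)\<bar> \<le> L * \<bar>r - t\<bar>"
    if "r \<in> {t0..t1}" "t \<in> {t0..t1}" for r t
    using lipschitz_onD[OF lip that] dist_fst_le[of "c r" "c t"] dist_snd_le[of "c r" "c t"]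
    by (auto simp: dist_real_def)
  have "(D * (B * B) * L)-lipschitz_on {t0..t1} (\<lambda>t. T (c t))"
  proof (rule lipschitz_onI)
    fix r t assume rt: "r \<in> {t0..t1}" "t \<in> {t0..t1}"
    have pos: "0 < snd (c r)" "0 < snd (c t)" using sub rt by (auto simp: mem_Aff_iff image_subset_iff)
    have "\<bar>T (c r) - T (c t)\<bar> = D * (\<bar>1 / snd (c r)\<bar> * \<bar>1 / snd (c t)\<bar> * \<bar>snd (c r) - snd (c t)\<bar>)"
    proof -
      have "T (c r) - T (c t) = s * (D * (1 / snd (c r) * (1 / snd (c t)) * (snd (c t) - snd (c r))))"
        using pos by (simp add: T_def field_simps)
      moreover have "\<bar>s\<bar> = 1" using s by auto
      ultimately show ?thesis using D by (simp add: abs_mult abs_minus_commute)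
    qed
    also have "\<dots> \<le> D * (B * B * (L * \<bar>r - t\<bar>))"
      using B[OF rt(1)] B[OF rt(2)] diff[OF rt] D L order_trans[OF abs_ge_zero B[OF rt(1)]]
      by (intro mult_left_mono mult_mono) auto
    finally show "dist (T (c r)) (T (c t)) \<le> D * (B * B) * L * dist r t"
      by (simp add: dist_real_def algebra_simps)
  qed (use D L in simp)
  then show "\<exists>M. M-lipschitz_on {t0..t1} (\<lambda>t. T (c t))" by blast
  have "((2 * a + \<bar>E\<bar>) * L)-lipschitz_on {t0..t1} (\<lambda>t. Q (c t))"
  proof (rule lipschitz_onI)
    fix r t assume rt: "r \<in> {t0..t1}" "t \<in> {t0..t1}"
    have "\<bar>Q (c r) - Q (c t)\<bar> = \<bar>2 * a * (fst (c r) - fst (c t)) + E * (snd (c r) - snd (c t))\<bar>"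
      by (simp add: Q_def algebra_simps)
    also have "\<dots> \<le> 2 * a * \<bar>fst (c r) - fst (c t)\<bar> + \<bar>E\<bar> * \<bar>snd (c r) - snd (c t)\<bar>"
      using a by (intro order_trans[OF abs_triangle_ineq]) (simp add: abs_mult)
    also have "\<dots> \<le> 2 * a * (L * \<bar>r - t\<bar>) + \<bar>E\<bar> * (L * \<bar>r - t\<bar>)"
      using diff[OF rt] a by (intro add_mono mult_left_mono) auto
    finally show "dist (Q (c r)) (Q (c t)) \<le> (2 * a + \<bar>E\<bar>) * L * dist r t"
      by (simp add: dist_real_def algebra_simps)
  qed (use a L in simp)
  then show "\<exists>M. M-lipschitz_on {t0..t1} (\<lambda>t. Q (c t))" by blast
qed

section \<open>The Lorentzian distance from the identity\<close>

text \<open>For each weight \<open>k > 0\<close> the integrand \<open>sqrt (T' Q')\<close> is at most the derivative of the Lipschitz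
  function \<open>k T / 2 + Q / (2 k)\<close>, so the length is at most the increment of that function.\<close>

lemma admissible_bounds:
  assumes "admissible A c t0 t1"
  shows "T (c t0) \<le> T (c t1)" "Q (c t0) \<le> Q (c t1)"
    and "lorentz_length A c t0 t1
      \<le> ennreal (sqrt ((T (c t1) - T (c t0)) * (Q (c t1) - Q (c t0))))"
proof -
  define v where "v t = vector_derivative c (at t within {t0..t1})" for t
  from assms obtain L where lt: "t0 < t1" and sub: "c ` {t0..t1} \<subseteq> Aff"
    and lip: "L-lipschitz_on {t0..t1} c"
    and ae: "AE t in lebesgue_on {t0..t1}. c differentiable (at t within {t0..t1}) \<and>
        future_nonspacelike A (velocity c t0 t1 t)"
    unfolding admissible_def by blast
  obtain M1 M2 where M: "M1-lipschitz_on {t0..t1} (\<lambda>t. T (c t))"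
      "M2-lipschitz_on {t0..t1} (\<lambda>t. Q (c t))"
    using T_Q_lipschitz[OF lip sub] by blast
  have space: "AE t in lebesgue_on {t0..t1}. t \<in> {t0..t1}"
    by (rule AE_I2) simp
  have ders: "AE t in lebesgue_on {t0..t1}. c t \<in> Aff \<and>
      ((\<lambda>t. T (c t)) has_real_derivative dT (c t) (v t)) (at t within {t0..t1}) \<and>
      ((\<lambda>t. Q (c t)) has_real_derivative dQ (v t)) (at t within {t0..t1}) \<and>
      0 \<le> dT (c t) (v t) \<and> 0 \<le> dQ (v t)"
    using ae space
  proof eventually_elim
    case (elim t)
    then have Aff: "c t \<in> Aff" using sub by blast
    moreover have "(c has_vector_derivative v t) (at t within {t0..t1})"
      using elim by (simp add: v_def flip: vector_derivative_works)
    moreover have "0 \<le> dT (c t) (v t) \<and> 0 \<le> dQ (v t)"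
      using elim unfolding velocity_def v_def[symmetric] future_nonspacelike_iff[OF Aff] by simp
    ultimately show ?case using T_Q_derivative by blast
  qed
  show mT: "T (c t0) \<le> T (c t1)"
    by (rule nn_integral_lipschitz_derivative(2)[OF lt M(1)]) (use ders in eventually_elim, blast)
  show mQ: "Q (c t0) \<le> Q (c t1)"
    by (rule nn_integral_lipschitz_derivative(2)[OF lt M(2)]) (use ders in eventually_elim, blast)
  have bound: "lorentz_length A c t0 t1
      \<le> ennreal ((k * (T (c t1) - T (c t0)) + (Q (c t1) - Q (c t0)) / k) / 2)" if k: "0 < k" for k
  proof -
    define f where "f t = k / 2 * T (c t) + 1 / (2 * k) * Q (c t)" for t
    define f' where "f' t = k / 2 * dT (c t) (v t) + 1 / (2 * k) * dQ (v t)" for t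
    have f_lip: "(\<bar>k / 2\<bar> * M1 + \<bar>1 / (2 * k)\<bar> * M2)-lipschitz_on {t0..t1} f"
      unfolding f_def by (intro lipschitz_on_add lipschitz_on_cmult_real M)
    have f_der: "AE t in lebesgue_on {t0..t1}.
        (f has_real_derivative f' t) (at t within {t0..t1}) \<and> 0 \<le> f' t"
      using ders
    proof eventually_elim
      case (elim t)
      then show ?case
        unfolding f_def f'_def using k by (auto intro!: derivative_eq_intros)
    qed
    have "lorentz_length A c t0 t1 \<le> (\<integral>\<^sup>+ t. ennreal (f' t) \<partial>lebesgue_on {t0..t1})"
      unfolding lorentz_length_def
    proof (rule nn_integral_mono_AE, use ders in eventually_elim)
      case (elim t)
      have "sqrt (dT (c t) (v t) * dQ (v t)) = sqrt ((k * dT (c t) (v t)) * (dQ (v t) / k))"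
        using k by simp
      also have "\<dots> \<le> (k * dT (c t) (v t) + dQ (v t) / k) / 2"
        using k elim by (intro arith_geo_mean_sqrt) auto
      also have "\<dots> = f' t" using k by (simp add: f'_def field_simps)
      finally show ?case
        using elim by (simp add: velocity_def lorentz_square_eq v_def[symmetric] ennreal_leI)
    qed
    also have "\<dots> = ennreal (f t1 - f t0)"
      by (rule nn_integral_lipschitz_derivative(1)[OF lt f_lip f_der])
    also have "f t1 - f t0 = (k * (T (c t1) - T (c t0)) + (Q (c t1) - Q (c t0)) / k) / 2"
      using k by (simp add: f_def field_simps)
    finally show ?thesis .
  qed
  \<comment> \<open>Any single weight shows that the length is finite, so it may be treated as a real number.\<close>
  obtain l where l: "0 \<le> l" "lorentz_length A c t0 t1 = ennreal l"
    using bound[of 1] by (cases "lorentz_length A c t0 t1") (auto simp: top_unique)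
  have "l \<le> sqrt ((T (c t1) - T (c t0)) * (Q (c t1) - Q (c t0)))"
  proof (rule le_sqrt_mult_of_weighted_means)
    fix k :: real assume k: "0 < k"
    then have "0 \<le> (k * (T (c t1) - T (c t0)) + (Q (c t1) - Q (c t0)) / k) / 2"
      using mT mQ by simp
    then show "l \<le> (k * (T (c t1) - T (c t0)) + (Q (c t1) - Q (c t0)) / k) / 2"
      using bound[OF k] l by (simp add: ennreal_le_iff)
  qed (use mT mQ in auto)
  then show "lorentz_length A c t0 t1
      \<le> ennreal (sqrt ((T (c t1) - T (c t0)) * (Q (c t1) - Q (c t0))))"
    using l by (simp add: ennreal_leI)
qed

lemma T_Q_aff_id [simp]: "T aff_id = 0" "Q aff_id = 0"
  by (simp_all add: T_def Q_def aff_id_def)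

lemma T_Q_inj:
  assumes "q \<in> Aff" "q' \<in> Aff" "T q = T q'" "Q q = Q q'"
  shows "q = q'"
proof -
  have "s * D \<noteq> 0" using s D by auto
  then have y: "snd q = snd q'"
    using assms(1-3) by (simp add: T_def mem_Aff_iff)
  then show ?thesis
    using assms(4) a by (simp add: Q_def prod_eq_iff)
qed

text \<open>The curve along which \<open>T\<close> and \<open>Q\<close> grow proportionally to the parameter: \<open>T\<close> is affine in
  \<open>1 / y\<close>, hence \<open>1 / y\<close> is interpolated linearly, and \<open>x\<close> is then found from \<open>Q\<close>.
  The integrand of the length is constant along it. The curve stays in the group because the values of \<open>1 / y\<close>
  are convex combinations of \<open>1\<close> and \<open>1 / snd q\<close>.\<close>

lemma exists_maximizer:
  assumes q: "q \<in> Aff" and TQ: "0 \<le> T q" "0 \<le> Q q"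
  shows "\<exists>c. admissible A c 0 1 \<and> c 0 = aff_id \<and> c 1 = q \<and>
    lorentz_length A c 0 1 = ennreal (sqrt (T q * Q q))"
proof -
  define m where "m = 1 / snd q - 1"
  define y where "y t = 1 / (1 + t * m)" for t
  define c where "c t = ((t * Q q - E * (y t - 1)) / (2 * a), y t)" for t
  define v where "v t = ((Q q - E * (- m * (y t)\<^sup>2)) / (2 * a), - m * (y t)\<^sup>2)" for t
  have yq: "0 < snd q" using q by (auto simp: mem_Aff_iff)
  have den: "0 < 1 + t * m" if "t \<in> {0..1}" for t
  proof -
    have "1 + t * m = (1 - t) + t / snd q" by (simp add: m_def algebra_simps)
    also have "\<dots> > 0" using that yq
      by (cases "t = 0") (auto intro: add_nonneg_pos)
    finally show ?thesis .
  qed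
  have Aff: "c t \<in> Aff" if "t \<in> {0..1}" for t
    using den[OF that] by (simp add: c_def y_def mem_Aff_iff)
  have y_der: "(y has_real_derivative - m * (y t)\<^sup>2) (at t within {0..1})" if "t \<in> {0..1}" for t
    using den[OF that] unfolding y_def
    by (auto intro!: derivative_eq_intros simp: power2_eq_square)
  have c_der: "(c has_vector_derivative v t) (at t within {0..1})" if "t \<in> {0..1}" for t
  proof -
    have "((\<lambda>t. (t * Q q - E * (y t - 1)) / (2 * a)) has_real_derivative
        (Q q - E * (- m * (y t)\<^sup>2)) / (2 * a)) (at t within {0..1})"
      using a by (auto intro!: derivative_eq_intros y_der[OF that] simp: field_simps)
    then show ?thesis
      using y_der[OF that] unfolding c_def v_def has_real_derivative_iff_has_vector_derivative
      by (intro has_vector_derivative_Pair)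
  qed
  have vd: "vector_derivative c (at t within {0..1}) = v t" if "t \<in> {0..1}" for t
    using that c_der[OF that] by (intro vector_derivative_within_closed_interval) auto
  have dTv: "dT (c t) (v t) = T q" and dQv: "dQ (v t) = Q q" if "t \<in> {0..1}" for t
    using den[OF that] a by (simp_all add: dT_def dQ_def c_def v_def T_def y_def m_def field_simps)
  have ends: "c 0 = aff_id" "c 1 = q"
    using yq a by (simp_all add: c_def y_def m_def aff_id_def Q_def prod_eq_iff)
  have v_cont: "continuous_on {0..1} v"
    unfolding v_def y_def using a den by (intro continuous_intros) force+
  obtain B where B: "\<And>t. t \<in> {0..1} \<Longrightarrow> norm (v t) \<le> B"
    using compact_imp_bounded[OF compact_continuous_image[OF v_cont compact_Icc]]
    unfolding bounded_iff by blast
  have "B-lipschitz_on {0..1} c"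
  proof (rule bounded_derivative_imp_lipschitz)
    show "(c has_derivative (\<lambda>x. x *\<^sub>R v t)) (at t within {0..1})" if "t \<in> {0..1}" for t
      using c_der[OF that] by (simp add: has_vector_derivative_def)
    show "onorm (\<lambda>x::real. x *\<^sub>R v t) \<le> B" if "t \<in> {0..1}" for t
    proof (rule onorm_le)
      fix x :: real
      show "norm (x *\<^sub>R v t) \<le> B * norm x"
        using mult_right_mono[OF B[OF that], of "\<bar>x\<bar>"] by (simp add: mult.commute)
    qed
    show "0 \<le> B" using order_trans[OF norm_ge_zero B[of 0]] by simp
  qed auto
  moreover have "AE t in lebesgue_on {0..1}. c differentiable (at t within {0..1}) \<and>
        future_nonspacelike A (velocity c 0 1 t)"
  proof (rule AE_I2)
    fix t :: real assume "t \<in> space (lebesgue_on {0..1})"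
    then have t: "t \<in> {0..1}" by simp
    show "c differentiable (at t within {0..1}) \<and> future_nonspacelike A (velocity c 0 1 t)"
      using c_der[OF t] TQ unfolding velocity_def vd[OF t] future_nonspacelike_iff[OF Aff[OF t]]
      by (auto simp: dTv[OF t] dQv[OF t] intro: differentiableI_vector)
  qed
  ultimately have "admissible A c 0 1"
    unfolding admissible_def using Aff by auto
  moreover have "lorentz_length A c 0 1 = (\<integral>\<^sup>+ t. ennreal (sqrt (T q * Q q)) \<partial>lebesgue_on {0..1::real})"
    unfolding lorentz_length_def velocity_def
    by (intro nn_integral_cong) (simp add: vd lorentz_square_eq Aff dTv dQv)
  ultimately show ?thesis
    using ends by (auto simp: emeasure_restrict_space)
qed

text \<open>If \<open>T q\<close> or \<open>Q q\<close> is negative, no admissible curve reaches \<open>q\<close>; if none is negative but one of them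
  vanishes, every such curve has length zero.\<close>

lemma lorentz_dist_eq:
  assumes q: "q \<in> Aff"
  shows "lorentz_dist A aff_id q = (if 0 < T q \<and> 0 < Q q then ennreal (sqrt (T q * Q q)) else 0)"
proof -
  let ?S = "{lorentz_length A c t0 t1 | c t0 t1. admissible A c t0 t1 \<and> c t0 = aff_id \<and> c t1 = q}"
  have upper: "0 \<le> T q \<and> 0 \<le> Q q \<and> l \<le> ennreal (sqrt (T q * Q q))" if "l \<in> ?S" for l
  proof -
    from that obtain c t0 t1 where c: "admissible A c t0 t1" "c t0 = aff_id" "c t1 = q"
      and l: "l = lorentz_length A c t0 t1" by blast
    show ?thesis
      using admissible_bounds[OF c(1)] by (simp add: c(2,3) l)
  qed
  show ?thesis
  proof (cases "0 < T q \<and> 0 < Q q")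
    case True
    then obtain c where "admissible A c 0 1" "c 0 = aff_id" "c 1 = q"
      and "lorentz_length A c 0 1 = ennreal (sqrt (T q * Q q))"
      using exists_maximizer[OF q] by force
    then have "ennreal (sqrt (T q * Q q)) \<in> ?S"
      by (metis (mono_tags, lifting) mem_Collect_eq)
    then have "Sup ?S = ennreal (sqrt (T q * Q q))"
      using upper by (intro Sup_eqI) auto
    then show ?thesis using True by (simp add: lorentz_dist_def)
  next
    case False
    have "l \<le> 0" if "l \<in> ?S" for l
      using upper[OF that] False by (auto simp: not_less)
    then have "Sup ?S \<le> 0" by (intro Sup_least)
    then show ?thesis using False by (auto simp: lorentz_dist_def)
  qed
qed

section \<open>The spheres\<close>

text \<open>For \<open>s = 1\<close> the functions \<open>- \<lambda>\<^sub>1\<close> and \<open>\<lambda>\<^sub>2\<close> are \<open>y T\<close> and \<open>Q\<close>, for \<open>s = -1\<close> they are \<open>Q\<close> and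
  \<open>y T\<close>.\<close>

lemma lambda_signs_iff:
  assumes "q \<in> Aff"
  shows "lambda1 A q < 0 \<and> 0 < lambda2 A q \<longleftrightarrow> 0 < T q \<and> 0 < Q q"
proof -
  have y: "0 < snd q" using assms by (simp add: mem_Aff_iff)
  have yT: "snd q * T q = - s * D * (snd q - 1)"
    using y by (simp add: T_def algebra_simps)
  have pos: "0 < T q \<longleftrightarrow> 0 < snd q * T q" using y by (simp add: zero_less_mult_iff)
  show ?thesis
    using s unfolding pos yT Q_def unfolding D_eq E_eq lambda1_def lambda2_def A11 A21
    by (auto simp: algebra_simps)
qed

text \<open>In terms of the parameters, \<open>\<gamma> = - s / D\<close>, \<open>f = s D / (2 a)\<close> and \<open>g = E / (2 a)\<close>, so \<open>w\<close> is
  \<open>s Q / D\<close>.\<close>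

lemma sphere_curve_eq:
  "sphere_curve A R = {(x, y). R\<^sup>2 * y = s * D * (1 - y) * (2 * a * x + E * (y - 1))}"
proof -
  have det: "det A = a * D" unfolding det_2 A11 A21 D_eq by (simp add: algebra_simps)
  then have det0: "det A \<noteq> 0" using a D by simp
  have \<gamma>: "matrix_inv A $ 2 $ 1 = - s / D"
    using a by (simp add: matrix_inv_2[OF det0] det A21)
  then have sgn: "sgn (matrix_inv A $ 2 $ 1) = - s" using s D by auto
  have ss: "s * s = 1" using s by auto
  have b: "A $ 1 $ 2 = (E - s * D) / 2" and d: "A $ 2 $ 2 = (D + s * E) / 2"
    using ss unfolding D_eq E_eq by algebra+
  have f: "f_coeff A = s * D / (2 * a)"
    using s a D unfolding f_coeff_def Let_def sgn
    by (auto simp: matrix_inv_2[OF det0] det A21 b d field_simps)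
  have g: "g_coeff A = E / (2 * a)"
    using s a D unfolding g_coeff_def Let_def sgn
    by (auto simp: matrix_inv_2[OF det0] det A21 b d field_simps)
  have w: "(x + g_coeff A * (y - 1)) / f_coeff A = s * (2 * a * x + E * (y - 1)) / D" for x y
    using s a D by (auto simp: f g field_simps)
  have "(s * w / D + (- s / D * R)\<^sup>2) * y = s * w / D \<longleftrightarrow> R\<^sup>2 * y = s * D * (1 - y) * w" for w y
  proof -
    have "D\<^sup>2 * ((s * w / D + (- s / D * R)\<^sup>2) * y - s * w / D) = R\<^sup>2 * y - s * D * (1 - y) * w"
      using s D by (auto simp: power2_eq_square field_simps)
    then show ?thesis using D by (metis eq_iff_diff_eq_0 mult_eq_0_iff power_not_zero less_irrefl)
  qed
  then show ?thesis
    unfolding sphere_curve_def Let_def w \<gamma> by simp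
qed

lemma mem_sphere_curve_iff:
  assumes "q \<in> Aff"
  shows "q \<in> sphere_curve A R \<longleftrightarrow> T q * Q q = R\<^sup>2"
proof -
  have y: "0 < snd q" using assms by (simp add: mem_Aff_iff)
  have "q \<in> sphere_curve A R \<longleftrightarrow> R\<^sup>2 * snd q = (snd q * T q) * Q q"
    using y unfolding sphere_curve_eq
    by (cases q) (simp add: T_def Q_def algebra_simps)
  also have "\<dots> \<longleftrightarrow> T q * Q q = R\<^sup>2" using y by auto
  finally show ?thesis .
qed

text \<open>The quadratic part of the equation is a product of independent linear forms, multiples of \<open>y\<close>
  and \<open>2 a x + E y\<close>. The conic degenerates, to the lines \<open>y = 1\<close> and \<open>Q = 0\<close>, only for \<open>R = 0\<close>.\<close>

lemma sphere_curve_is_hyperbola: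
  assumes "R \<noteq> 0"
  shows "is_hyperbola (sphere_curve A R)"
  unfolding is_hyperbola_def
proof (intro exI conjI)
  let ?p = "0 :: real" and ?q = "- 2 * a * s * D" and ?r = "- s * D * E" and ?s = "2 * a * s * D"
    and ?t = "2 * s * D * E - R\<^sup>2" and ?u = "- s * D * E"
  show "sphere_curve A R
      = {(x, y). ?p * x\<^sup>2 + ?q * x * y + ?r * y\<^sup>2 + ?s * x + ?t * y + ?u = 0}"
    unfolding sphere_curve_eq by (auto simp: power2_eq_square algebra_simps)
  have q: "?q \<noteq> 0" using s a D by auto
  then show "?q\<^sup>2 - 4 * ?p * ?r > 0" by simp
  have "4 * ?p * ?r * ?u + ?q * ?s * ?t - ?p * ?t\<^sup>2 - ?r * ?s\<^sup>2 - ?u * ?q\<^sup>2 = R\<^sup>2 * ?q\<^sup>2"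
    by (simp add: power2_eq_square algebra_simps)
  then show "4 * ?p * ?r * ?u + ?q * ?s * ?t - ?p * ?t\<^sup>2 - ?r * ?s\<^sup>2 - ?u * ?q\<^sup>2 \<noteq> 0"
    using q assms by simp
qed

text \<open>On the level set \<open>Q\<close> is determined by \<open>T\<close>, hence by \<open>y\<close>, and \<open>T > 0\<close> says that \<open>y\<close> lies below
  \<open>1\<close> if \<open>s = 1\<close> and above \<open>1\<close> if \<open>s = -1\<close>. In both cases \<open>r y\<close>, which is \<open>1 / y\<close> or \<open>y\<close>,
  ranges over \<open>{1<..}\<close> and is taken as \<open>1 + exp \<theta>\<close>. It tends to \<open>\<infinity>\<close> at one end, and \<open>Q\<close>
  does so at the other; both functions are bounded on compact subsets of the group.\<close>

lemma noncompact_arc_level_set: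
  assumes "R \<noteq> 0"
  shows "noncompact_arc {q \<in> Aff. 0 < T q \<and> 0 < Q q \<and> T q * Q q = R\<^sup>2}" (is "noncompact_arc ?S")
proof -
  define z :: "real \<Rightarrow> real" where "z \<theta> = 1 + exp \<theta>" for \<theta>
  define r where "r y = (if s = 1 then 1 / y else y)" for y :: real
  \<comment> \<open>The value of \<open>T\<close> at the point with parameter \<open>\<theta>\<close>.\<close>
  define p where "p \<theta> = s * D * (1 / r (z \<theta>) - 1)" for \<theta>
  define \<phi> where "\<phi> \<theta> = ((R\<^sup>2 / p \<theta> - E * (r (z \<theta>) - 1)) / (2 * a), r (z \<theta>))" for \<theta>
  have z: "1 < z \<theta>" for \<theta> by (simp add: z_def)
  have r_r [simp]: "r (r y) = y" for y by (simp add: r_def)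
  have y: "0 < r (z \<theta>)" for \<theta> using z[of \<theta>] by (simp add: r_def)
  have p_eq: "p \<theta> = (if s = 1 then D * exp \<theta> else D * (exp \<theta> / z \<theta>))" for \<theta>
  proof -
    have "exp \<theta> = z \<theta> - 1" "z \<theta> \<noteq> 0"
      using z[of \<theta>] by (simp add: z_def, linarith)
    then show ?thesis using s by (auto simp: p_def r_def diff_divide_distrib)
  qed
  have p: "0 < p \<theta>" for \<theta> using D z[of \<theta>] by (simp add: p_eq)
  have Aff: "\<phi> \<theta> \<in> Aff" for \<theta> using y by (simp add: \<phi>_def mem_Aff_iff)
  have T\<phi>: "T (\<phi> \<theta>) = p \<theta>" for \<theta> by (simp add: T_def \<phi>_def p_def)
  have Q\<phi>: "Q (\<phi> \<theta>) = R\<^sup>2 / p \<theta>" for \<theta> using a by (simp add: Q_def \<phi>_def)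
  have r_cont: "continuous_on {0<..} r"
    unfolding r_def by (cases "s = 1") (auto intro!: continuous_intros)
  have rz_cont: "continuous_on UNIV (\<lambda>\<theta>. r (z \<theta>))"
    by (rule continuous_on_compose2[OF r_cont])
      (use z in \<open>auto simp: z_def intro!: continuous_intros intro: less_trans[OF zero_less_one]\<close>)
  have p_cont: "continuous_on UNIV p"
    unfolding p_def using y by (intro continuous_intros rz_cont) (metis less_irrefl)
  have "continuous_on UNIV \<phi>"
    unfolding \<phi>_def using p a by (intro continuous_intros rz_cont p_cont) (auto, metis less_irrefl)
  moreover have "inj \<phi>"
  proof (rule injI)
    fix \<theta> \<theta>' assume "\<phi> \<theta> = \<phi> \<theta>'"
    then have "r (r (z \<theta>)) = r (r (z \<theta>'))" by (simp add: \<phi>_def)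
    then show "\<theta> = \<theta>'" by (simp add: z_def)
  qed
  moreover have "range \<phi> = ?S"
  proof (intro equalityI subsetI)
    fix q assume "q \<in> range \<phi>"
    then obtain \<theta> where "q = \<phi> \<theta>" by blast
    then show "q \<in> ?S" using Aff[of \<theta>] p[of \<theta>] assms by (simp add: T\<phi> Q\<phi>)
  next
    fix q assume q: "q \<in> ?S"
    then have yq: "0 < snd q" by (simp add: mem_Aff_iff)
    have "1 < r (snd q)"
      using q s D yq by (auto simp: T_def r_def zero_less_mult_iff field_simps)
    then have "z (ln (r (snd q) - 1)) = r (snd q)" by (simp add: z_def)
    then have snd_eq: "snd q = snd (\<phi> (ln (r (snd q) - 1)))" by (simp add: \<phi>_def)
    then have T_eq: "T q = T (\<phi> (ln (r (snd q) - 1)))" by (simp add: T_def)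
    moreover have "Q q = Q (\<phi> (ln (r (snd q) - 1)))"
      using q T_eq by (simp add: Q\<phi> T\<phi> field_simps)
    ultimately have "q = \<phi> (ln (r (snd q) - 1))"
      using q Aff T_Q_inj by blast
    then show "q \<in> range \<phi>" by blast
  qed
  moreover have "(\<forall>\<^sub>F \<theta> in at_top. \<phi> \<theta> \<notin> K) \<and> (\<forall>\<^sub>F \<theta> in at_bot. \<phi> \<theta> \<notin> K)"
    if K: "compact K" "K \<subseteq> Aff" for K
  proof
    have "continuous_on K (\<lambda>q. r (snd q))"
      by (rule continuous_on_compose2[OF r_cont]) (use K in \<open>auto intro!: continuous_intros simp: mem_Aff_iff\<close>)
    moreover have "filterlim (\<lambda>\<theta>. r (snd (\<phi> \<theta>))) at_top at_top"
      unfolding \<phi>_def z_def by (auto intro!: filterlim_tendsto_add_at_top exp_at_top)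
    ultimately show "\<forall>\<^sub>F \<theta> in at_top. \<phi> \<theta> \<notin> K"
      by (rule eventually_notin_compact[OF K(1)])
    have "((\<lambda>\<theta>. D * exp \<theta>) \<longlongrightarrow> D * 0) at_bot" "((\<lambda>\<theta>. D * (exp \<theta> / (1 + exp \<theta>))) \<longlongrightarrow> D * (0 / (1 + 0))) at_bot"
      by (intro tendsto_intros exp_at_bot; simp)+
    then have "(p \<longlongrightarrow> 0) at_bot"
      unfolding p_eq[abs_def] z_def by (cases "s = 1") simp_all
    then have "filterlim p (at_right 0) at_bot"
      using p less_imp_neq[OF p, symmetric] by (simp add: filterlim_at)
    then have "filterlim (\<lambda>\<theta>. R\<^sup>2 / p \<theta>) at_top at_bot"
      unfolding divide_inverse using assms
      by (intro filterlim_tendsto_pos_mult_at_top[OF tendsto_const] filterlim_compose[OF filterlim_inverse_at_top_right]) auto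
    moreover have "continuous_on K Q"
      unfolding Q_def by (intro continuous_intros)
    ultimately show "\<forall>\<^sub>F \<theta> in at_bot. \<phi> \<theta> \<notin> K"
      using eventually_notin_compact[OF K(1), of Q \<phi> at_bot] unfolding Q\<phi> by blast
  qed
  ultimately show ?thesis
    unfolding noncompact_arc_def by blast
qed

lemma lorentz_sphere_pos:
  assumes R: "0 < R"
  shows "lorentz_sphere A (ennreal R) = {q \<in> Aff. 0 < T q \<and> 0 < Q q \<and> T q * Q q = R\<^sup>2}"
proof -
  have "lorentz_dist A aff_id q = ennreal R \<longleftrightarrow> 0 < T q \<and> 0 < Q q \<and> T q * Q q = R\<^sup>2"
    if "q \<in> Aff" for q
  proof (cases "0 < T q \<and> 0 < Q q")
    case True
    then have "lorentz_dist A aff_id q = ennreal R \<longleftrightarrow> sqrt (T q * Q q) = R"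
      using R that by (simp add: lorentz_dist_eq)
    also have "\<dots> \<longleftrightarrow> T q * Q q = R\<^sup>2"
      using True R by (auto simp: real_sqrt_unique)
    finally show ?thesis using True by blast
  next
    case False
    then show ?thesis using R that by (auto simp: lorentz_dist_eq ennreal_eq_0_iff)
  qed
  then show ?thesis by (auto simp: lorentz_sphere_def)
qed

end

theorem corollary6:
  fixes A :: "real ^ 2 ^ 2"
  assumes "det A > 0" and "A $ 1 $ 1 \<ge> 0" and "sectional_curvature A = 0"
  shows "lorentz_sphere A 0 = {q \<in> Aff. lambda1 A q \<ge> 0 \<or> lambda2 A q \<le> 0} \<and>
    (\<forall>R::real. 0 < R \<longrightarrow>
       lorentz_sphere A (ennreal R)
         = {q \<in> Aff. lambda1 A q < 0 \<and> lambda2 A q > 0 \<and> q \<in> sphere_curve A R} \<and>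
       is_hyperbola (sphere_curve A R) \<and>
       noncompact_arc (lorentz_sphere A (ennreal R))) \<and>
    lorentz_sphere A \<infinity> = {}"
proof -
  let ?a = "A $ 1 $ 1" and ?b = "A $ 1 $ 2" and ?c = "A $ 2 $ 1" and ?d = "A $ 2 $ 2"
  have "?c\<^sup>2 = ?a\<^sup>2"
    using assms(1,3) by (simp add: sectional_curvature_eq)
  then have "?c = ?a \<or> ?c = - ?a" by (simp add: power2_eq_iff)
  then obtain s :: real where s: "s = 1 \<or> s = -1" and c: "?c = s * ?a"
    using that[of 1] that[of "-1"] by auto
  have "det A = ?a * (?d - s * ?b)" by (simp add: det_2 c algebra_simps)
  then have "0 < ?a" "0 < ?d - s * ?b"
    using assms(1,2) by (auto simp: zero_less_mult_iff)
  then interpret flat_structure A s ?a "?d - s * ?b" "?b + s * ?d"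
    using s c by unfold_locales auto
  have "lorentz_sphere A 0 = {q \<in> Aff. lambda1 A q \<ge> 0 \<or> lambda2 A q \<le> 0}"
  proof -
    have "lorentz_dist A aff_id q = 0 \<longleftrightarrow> \<not> (0 < T q \<and> 0 < Q q)" if "q \<in> Aff" for q
      using that by (simp add: lorentz_dist_eq ennreal_eq_0_iff not_le)
    then show ?thesis
      using lambda_signs_iff by (auto simp: lorentz_sphere_def not_less[symmetric])
  qed
  moreover have "lorentz_sphere A (ennreal R)
         = {q \<in> Aff. lambda1 A q < 0 \<and> lambda2 A q > 0 \<and> q \<in> sphere_curve A R} \<and>
       is_hyperbola (sphere_curve A R) \<and> noncompact_arc (lorentz_sphere A (ennreal R))"
    if "0 < R" for R
    using that lambda_signs_iff mem_sphere_curve_iff sphere_curve_is_hyperbola noncompact_arc_level_set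
    unfolding lorentz_sphere_pos[OF that] by auto
  moreover have "lorentz_sphere A \<infinity> = {}"
    by (auto simp: lorentz_sphere_def lorentz_dist_eq)
  ultimately show ?thesis by blast
qed

end
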